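(* Let $T$ be a complex $2$-torus and let $E\subset T$ be finite. Then there exists an open set $U\subset T$ containing $E$ and a dominating map from $\mathbb{C}^2$ into the complement of $U$, i.e. a holomorphic map $F:\mathbb{C}^2\to T$ with $F(\mathbb{C}^2)\subset T\setminus U$ whose Jacobian determinant is not identically zero.
   Context: A complex $2$-torus is a quotient $\mathbb{C}^2/\Lambda$ with $\Lambda$ a lattice of real rank $4$. *)

theory Defs
  imports "HOL-Analysis.Analysis"
begin

section \<open>Holomorphic maps between open subsets of complex 2-space\<close>

(* Complex differentiability: the real Frechet derivative is given by a complex matrix. *)
definition holomorphic2_on :: "(complex^2 \<Rightarrow> complex^2) \<Rightarrow> (complex^2) set \<Rightarrow> bool" where
  "holomorphic2_on g S \<longleftrightarrow>
     open S \<and> (\<forall>z\<in>S. \<exists>A::complex^2^2. (g has_derivative (\<lambda>v. A *v v)) (at z))"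

(* Only meaningful at points where g is complex differentiable; the matrix below is then the
   complex 2x2 matrix of partial derivatives. *)
definition jacobian_det :: "(complex^2 \<Rightarrow> complex^2) \<Rightarrow> complex^2 \<Rightarrow> complex" where
  "jacobian_det g z = det (matrix (frechet_derivative g (at z)))"

lemma jacobian_det_eq:
  fixes A :: "complex^2^2"
  assumes "(g has_derivative (\<lambda>v. A *v v)) (at z)"
  shows "jacobian_det g z = det A"
  by (simp add: jacobian_det_def matrix_of_matrix_vector_mul flip: frechet_derivative_at[OF assms])


section \<open>Complex 2-tori\<close>

(* independent is linear independence over the reals. *)
definition full_lattice :: "(complex^2) set \<Rightarrow> bool" where
  "full_lattice L \<longleftrightarrow>
     (\<exists>B. independent B \<and> card B = 4 \<and> L = {(\<Sum>b\<in>B. of_int (c b) *\<^sub>R b) | c :: complex^2 \<Rightarrow> int. True})"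

definition torus_proj :: "(complex^2) set \<Rightarrow> complex^2 \<Rightarrow> (complex^2) set" where
  "torus_proj L z = (\<lambda>l. z + l) ` L"

lemma torus_proj_eq_iff:
  assumes "full_lattice L"
  shows "torus_proj L z = torus_proj L w \<longleftrightarrow> z - w \<in> L"
proof -
  obtain B where L: "L = {(\<Sum>b\<in>B. of_int (c b) *\<^sub>R b) | c :: complex^2 \<Rightarrow> int. True}"
    using assms unfolding full_lattice_def by blast
  have zero: "0 \<in> L"
    unfolding L by (auto intro!: exI[of _ "\<lambda>_. 0"])
  have diff: "x - y \<in> L" if xy: "x \<in> L" "y \<in> L" for x y
  proof -
    obtain c d :: "complex^2 \<Rightarrow> int"
      where "x = (\<Sum>b\<in>B. of_int (c b) *\<^sub>R b)" "y = (\<Sum>b\<in>B. of_int (d b) *\<^sub>R b)"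
      using xy unfolding L by blast
    then have "x - y = (\<Sum>b\<in>B. of_int (c b - d b) *\<^sub>R b)"
      by (simp add: sum_subtractf scaleR_diff_left)
    then show ?thesis
      unfolding L by (intro CollectI exI[of _ "\<lambda>b. c b - d b"]) simp
  qed
  have add: "x + y \<in> L" if "x \<in> L" "y \<in> L" for x y
    using diff[OF that(1) diff[OF zero that(2)]] by simp
  have mem: "x \<in> torus_proj L u \<longleftrightarrow> x - u \<in> L" for x u
    unfolding torus_proj_def image_iff by (metis add_diff_cancel_left' add.commute diff_add_cancel)
  show ?thesis
  proof
    assume "torus_proj L z = torus_proj L w"
    then show "z - w \<in> L"
      using mem[of z z] mem[of z w] zero by simp
  next
    assume zw: "z - w \<in> L"
    have "x - z \<in> L \<longleftrightarrow> x - w \<in> L" for x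
      using add[OF _ zw, of "x - z"] diff[OF _ zw, of "x - w"] by (auto simp: algebra_simps)
    then show "torus_proj L z = torus_proj L w"
      by (auto simp: mem)
  qed
qed

definition torus :: "(complex^2) set \<Rightarrow> (complex^2) set set" where
  "torus L = range (torus_proj L)"

definition torus_topology :: "(complex^2) set \<Rightarrow> (complex^2) set topology" where
  "torus_topology L = topology (\<lambda>U. U \<subseteq> torus L \<and> open (torus_proj L -` U))"

lemma openin_torus_topology:
  "openin (torus_topology L) U \<longleftrightarrow> U \<subseteq> torus L \<and> open (torus_proj L -` U)"
proof -
  have "istopology (\<lambda>U. U \<subseteq> torus L \<and> open (torus_proj L -` U))"
    unfolding istopology_def by (auto simp: vimage_Union)
  then show ?thesis
    by (simp add: torus_topology_def topology_inverse')
qed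

lemma topspace_torus_topology [simp]: "topspace (torus_topology L) = torus L"
proof -
  have "openin (torus_topology L) (torus L)"
    by (simp add: openin_torus_topology torus_def vimage_def)
  then show ?thesis
    by (meson openin_subset openin_topspace openin_torus_topology subset_antisym)
qed

lemma quotient_map_torus_proj: "quotient_map euclidean (torus_topology L) (torus_proj L)"
  by (auto simp: quotient_map_def openin_torus_topology torus_def vimage_def)


section \<open>Holomorphic maps into a torus\<close>

(* The complex structure of the torus: for every open V on which the projection is injective,
   the inverse of the restricted projection is a chart with domain the image of V. *)
definition chart_range :: "(complex^2) set \<Rightarrow> (complex^2) set \<Rightarrow> bool" where
  "chart_range L V \<longleftrightarrow> open V \<and> inj_on (torus_proj L) V"

definition torus_chart :: "(complex^2) set \<Rightarrow> (complex^2) set \<Rightarrow> (complex^2) set \<Rightarrow> complex^2" where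
  "torus_chart L V = the_inv_into V (torus_proj L)"

definition holomorphic_to_torus :: "(complex^2) set \<Rightarrow> (complex^2 \<Rightarrow> (complex^2) set) \<Rightarrow> bool" where
  "holomorphic_to_torus L F \<longleftrightarrow>
     continuous_map euclidean (torus_topology L) F \<and>
     (\<forall>V. chart_range L V \<longrightarrow>
        holomorphic2_on (torus_chart L V \<circ> F) {z. F z \<in> torus_proj L ` V})"

(* The Jacobian determinant of F at z is computed in a chart around F z. Transition maps
   are locally translations by lattice vectors, so it does not depend on the chart. *)
definition dominating :: "(complex^2) set \<Rightarrow> (complex^2 \<Rightarrow> (complex^2) set) \<Rightarrow> bool" where
  "dominating L F \<longleftrightarrow> holomorphic_to_torus L F \<and>
     (\<exists>z V. chart_range L V \<and> F z \<in> torus_proj L ` V \<and> jacobian_det (torus_chart L V \<circ> F) z \<noteq> 0)"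

end

theory Submission
  imports Defs "HOL-Complex_Analysis.Cauchy_Integral_Formula"
begin

text \<open>
  The proof looks for a nondegenerate entire map \<open>f\<close> of the complex plane squared that stays away from
  a neighbourhood of all lattice translates of \<open>E\<close>. It rests on three observations.

  In suitable complex linear coordinates both coordinates of every lattice point have integral real part
  (\<open>full_lattice_complex_coords\<close>). By Dirichlet's theorem the coordinates can be rescaled by a
  positive integer so that the points of \<open>E\<close> too have both real parts close to integers
  (\<open>simultaneous_approximation\<close>). After a translation by \<open>1/2\<close> it suffices to avoid
  the set \<open>K\<close> of points whose first real part is near an integer and whose second real part is near a
  half integer. On \<open>K\<close> the second coordinate is bounded away from \<open>0\<close>.

  There is an entire function of the first coordinate whose real part is at least \<open>64 + 4 * norm z\<close> on
  all strips around the lines of integral real part (\<open>Re_weight_ge\<close>). Multiplying the second coordinate by the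
  exponential of that function is an automorphism. As the second coordinate is bounded below on \<open>K\<close>, this
  automorphism carries \<open>K\<close> into the region where the modulus of the second coordinate exceeds both \<open>16\<close> and
  the modulus of the first (\<open>overshear_avoids\<close>).

  The complement of that region is forward invariant under a Henon map with a repelling fixed point at the
  origin (\<open>henon_preserves\<close>). The associated Poincare function, the limit of the \<open>n\<close>-th iterate of
  the Henon map after the \<open>n\<close>-th iterate of the inverse of its linear part, is entire, has the identity as
  derivative at the origin, and takes its values in forward orbits of points near the origin, hence in the
  complement (\<open>henon_poincare_avoids\<close>). Following it by the inverse automorphism, the inverse
  coordinate change and the projection to the torus gives the required map.
\<close>

section \<open>Holomorphic maps in two complex variables\<close>

lemma norm_vector_smult: "norm (c *s v) = norm c * norm v" for v :: "complex^'n"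
  by (simp add: norm_vec_def norm_mult L2_set_right_distrib)

lemma norm_axis: "norm (axis i x) = norm x" for x :: "'a::real_normed_vector"
proof -
  have "(\<Sum>j\<in>UNIV. (norm (axis i x $ j))\<^sup>2) = (\<Sum>j\<in>UNIV. if j = i then (norm x)\<^sup>2 else 0)"
    by (intro sum.cong) (auto simp: axis_def)
  then show ?thesis
    by (simp add: norm_vec_def L2_set_def)
qed

lemma has_derivative_vec2I:
  fixes f :: "complex^2 \<Rightarrow> complex^2"
  assumes "((\<lambda>x. f x $ 1) has_derivative (\<lambda>v. a * v $ 1 + b * v $ 2)) (at z)"
    and "((\<lambda>x. f x $ 2) has_derivative (\<lambda>v. c * v $ 1 + d * v $ 2)) (at z)"
  shows "(f has_derivative (\<lambda>v. vector [vector [a, b], vector [c, d]] *v v)) (at z)"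
proof -
  let ?A = "vector [vector [a, b], vector [c, d]] :: complex^2^2"
  have A: "(?A *v v) $ 1 = a * v $ 1 + b * v $ 2" "(?A *v v) $ 2 = c * v $ 1 + d * v $ 2" for v
    by (simp_all add: matrix_vector_mult_def sum_2)
  have "((\<lambda>y. (f y - f z - ?A *v (y - z)) /\<^sub>R norm (y - z)) \<longlongrightarrow> 0) (at z)"
  proof (rule vec_tendstoI)
    fix i :: 2
    have "((\<lambda>y. (f y $ i - f z $ i - (?A *v (y - z)) $ i) /\<^sub>R norm (y - z)) \<longlongrightarrow> 0) (at z)"
      using assms exhaust_2[of i] by (auto simp: has_derivative_at_within A)
    then show "((\<lambda>y. ((f y - f z - ?A *v (y - z)) /\<^sub>R norm (y - z)) $ i) \<longlongrightarrow> 0 $ i) (at z)"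
      by simp
  qed
  then show ?thesis
    by (simp add: has_derivative_at_within)
qed

lemma norm_vec2: "norm z = sqrt ((norm (z $ 1))\<^sup>2 + (norm (z $ 2))\<^sup>2)" for z :: "complex^2"
  by (simp add: norm_vec_def L2_set_def sum_2)

lemma norm_complex2_le: "norm x \<le> norm (x $ 1) + norm (x $ 2)" for x :: "complex^2"
  using L2_set_le_sum[of UNIV "\<lambda>i. norm (x $ i)"] by (simp add: norm_vec_def sum_2)

lemma holomorphic2_on_compose:
  assumes "holomorphic2_on f S" "holomorphic2_on g T" "f ` S \<subseteq> T"
  shows "holomorphic2_on (\<lambda>z. g (f z)) S"
  unfolding holomorphic2_on_def
proof (intro conjI ballI)
  show "open S" using assms(1) by (simp add: holomorphic2_on_def)
  fix z assume "z \<in> S"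
  then obtain A B :: "complex^2^2" where "(f has_derivative (\<lambda>v. A *v v)) (at z)"
    "(g has_derivative (\<lambda>v. B *v v)) (at (f z))"
    using assms unfolding holomorphic2_on_def by blast
  from has_derivative_compose[OF this]
  show "\<exists>A::complex^2^2. ((\<lambda>z. g (f z)) has_derivative (\<lambda>v. A *v v)) (at z)"
    by (auto simp: matrix_vector_mul_assoc)
qed

lemma holomorphic2_on_cong:
  assumes "holomorphic2_on f S" "\<And>z. z \<in> S \<Longrightarrow> g z = f z"
  shows "holomorphic2_on g S"
  unfolding holomorphic2_on_def
proof (intro conjI ballI)
  show "open S" using assms(1) by (simp add: holomorphic2_on_def)
  fix z assume "z \<in> S"
  then obtain A :: "complex^2^2" where "(f has_derivative (\<lambda>v. A *v v)) (at z)"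
    using assms(1) unfolding holomorphic2_on_def by blast
  then have "(g has_derivative (\<lambda>v. A *v v)) (at z)"
    by (rule has_derivative_transform_within_open[OF _ \<open>open S\<close> \<open>z \<in> S\<close>]) (simp add: assms(2))
  then show "\<exists>A::complex^2^2. (g has_derivative (\<lambda>v. A *v v)) (at z)" ..
qed

text \<open>Cauchy's inequality for one variable, applied to each component of \<open>t \<mapsto> h (z + t *s v)\<close> on the disc
  of radius \<open>r / norm v\<close>: the derivative at \<open>0\<close> of that function is the component of \<open>A *v v\<close>.
  The factor \<open>2\<close> comes from summing two components.\<close>

lemma cauchy_estimate_derivative:
  fixes h :: "complex^2 \<Rightarrow> complex^2" and A :: "complex^2^2"
  assumes diff: "\<And>w. w \<in> cball z r \<Longrightarrow> \<exists>M::complex^2^2. (h has_derivative (\<lambda>v. M *v v)) (at w)"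
    and bound: "\<And>w. w \<in> cball z r \<Longrightarrow> norm (h w) \<le> B"
    and "r > 0" and A: "(h has_derivative (\<lambda>v. A *v v)) (at z)"
  shows "norm (A *v v) \<le> 2 * B / r * norm v"
proof (cases "v = 0")
  case False
  define s where "s = r / norm v"
  have "s > 0" using False \<open>r > 0\<close> by (simp add: s_def)
  have lin: "((\<lambda>t. z + t *s v) has_derivative (\<lambda>t. t *s v)) (at t)" for t
  proof -
    have "linear (\<lambda>t. t *s v)"
      by (rule linearI) (simp_all add: vec_eq_iff algebra_simps)
    then have "bounded_linear (\<lambda>t. t *s v)"
      by (simp add: linear_conv_bounded_linear)
    then show ?thesis
      by (auto intro!: derivative_eq_intros bounded_linear_imp_has_derivative)
  qed
  have in_ball: "z + t *s v \<in> cball z r" if "norm t \<le> s" for t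
  proof -
    have "norm t * norm v \<le> s * norm v"
      using that by (intro mult_right_mono) auto
    then show ?thesis
      using False by (simp add: dist_norm norm_vector_smult s_def)
  qed
  have comp: "norm ((A *v v) $ i) \<le> B / s" for i
  proof -
    define \<phi> where "\<phi> t = h (z + t *s v) $ i" for t
    have deriv: "(\<phi> has_field_derivative (M *v v) $ i) (at t)"
      if "(h has_derivative (\<lambda>v. M *v v)) (at (z + t *s v))" for t and M :: "complex^2^2"
    proof -
      have "((\<lambda>t. h (z + t *s v)) has_derivative (\<lambda>t. M *v (t *s v))) (at t)"
        using has_derivative_compose[OF lin that] .
      then have "(\<phi> has_derivative (\<lambda>t. (M *v (t *s v)) $ i)) (at t)"
        unfolding \<phi>_def by (rule bounded_linear.has_derivative[OF bounded_linear_vec_nth])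
      moreover have "(\<lambda>t. (M *v (t *s v)) $ i) = (*) ((M *v v) $ i)"
        by (auto simp: vec.scale fun_eq_iff)
      ultimately show ?thesis
        by (simp add: has_field_derivative_def)
    qed
    have dif: "\<phi> field_differentiable at t" if "norm t \<le> s" for t
      using diff[OF in_ball[OF that]] deriv unfolding field_differentiable_def by blast
    have "norm ((deriv ^^ 1) \<phi> 0) \<le> fact 1 * B / s ^ 1"
    proof (rule Cauchy_inequality)
      show "\<phi> holomorphic_on ball 0 s"
        using dif by (auto simp: holomorphic_on_def intro: field_differentiable_at_within)
      show "continuous_on (cball 0 s) \<phi>"
        using dif by (auto intro!: continuous_at_imp_continuous_on field_differentiable_imp_continuous_at)
      fix t :: complex assume "norm (0 - t) = s"
      then have "norm (h (z + t *s v)) \<le> B"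
        by (intro bound in_ball) simp
      then show "norm (\<phi> t) \<le> B"
        unfolding \<phi>_def by (rule order_trans[OF Finite_Cartesian_Product.norm_nth_le])
    qed (fact \<open>s > 0\<close>)
    moreover have "deriv \<phi> 0 = (A *v v) $ i"
      by (rule DERIV_imp_deriv, rule deriv) (use A in simp)
    ultimately show ?thesis
      by simp
  qed
  have "norm (A *v v) \<le> B / s + B / s"
    using norm_complex2_le[of "A *v v"] comp[of 1] comp[of 2] by linarith
  then show ?thesis
    by (simp add: s_def)
qed simp

text \<open>Weierstrass' theorem in two variables. The Cauchy estimate turns uniform convergence of the maps into
  uniform convergence of their derivatives on a smaller ball, where real differentiation under the limit
  applies; the limit derivative is still given by a complex matrix because matrices converge entrywise.\<close>

theorem holomorphic2_on_uniform_limit: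
  fixes f :: "nat \<Rightarrow> complex^2 \<Rightarrow> complex^2"
  assumes hol: "\<And>n. holomorphic2_on (f n) S" and lim: "uniform_limit S f g sequentially"
  shows "holomorphic2_on g S"
  unfolding holomorphic2_on_def
proof (intro conjI ballI)
  show "open S"
    using hol by (simp add: holomorphic2_on_def)
  fix z0 assume "z0 \<in> S"
  then obtain r where "r > 0" and r: "cball z0 (2 * r) \<subseteq> S"
    using \<open>open S\<close> by (metis field_sum_of_halves mult_2 half_gt_zero open_contains_cball)
  let ?T = "ball z0 r"
  have sub: "cball z r \<subseteq> S" if "z \<in> ?T" for z
  proof
    fix w assume "w \<in> cball z r"
    then have "dist z0 w \<le> 2 * r"
      using that dist_triangle[of z0 w z] by (simp add: dist_commute)
    then show "w \<in> S" using r by auto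
  qed
  have sub0: "?T \<subseteq> S" using sub \<open>r > 0\<close> by (auto intro: subsetD[OF sub])
  obtain D :: "nat \<Rightarrow> complex^2 \<Rightarrow> complex^2^2"
    where D: "\<And>n z. z \<in> S \<Longrightarrow> (f n has_derivative (\<lambda>v. D n z *v v)) (at z)"
    using hol unfolding holomorphic2_on_def by metis
  have cauchy: "\<exists>N. \<forall>m\<ge>N. \<forall>n\<ge>N. \<forall>z\<in>?T. \<forall>v. norm ((D m z - D n z) *v v) \<le> e * norm v"
    if "e > 0" for e
  proof -
    have "e * r / 2 > 0" using that \<open>r > 0\<close> by simp
    moreover have "uniformly_Cauchy_on S f"
      using lim by (auto intro!: uniformly_convergent_Cauchy simp: uniformly_convergent_on_def)
    ultimately obtain N where N: "\<And>z m n. z \<in> S \<Longrightarrow> m \<ge> N \<Longrightarrow> n \<ge> N \<Longrightarrow> dist (f m z) (f n z) < e * r / 2"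
      unfolding uniformly_Cauchy_on_def by meson
    have "norm ((D m z - D n z) *v v) \<le> 2 * (e * r / 2) / r * norm v"
      if "m \<ge> N" "n \<ge> N" "z \<in> ?T" for m n z v
    proof (rule cauchy_estimate_derivative)
      have der: "((\<lambda>w. f m w - f n w) has_derivative (\<lambda>v. (D m w - D n w) *v v)) (at w)"
        if "w \<in> cball z r" for w
        using has_derivative_diff[OF D D, of w] sub[OF \<open>z \<in> ?T\<close>] that
        by (auto simp: matrix_vector_mult_diff_rdistrib)
      then show "\<exists>M::complex^2^2. ((\<lambda>w. f m w - f n w) has_derivative (\<lambda>v. M *v v)) (at w)"
        if "w \<in> cball z r" for w using that by blast
      show "((\<lambda>w. f m w - f n w) has_derivative (\<lambda>v. (D m z - D n z) *v v)) (at z)"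
        using der \<open>r > 0\<close> by simp
      show "norm (f m w - f n w) \<le> e * r / 2" if "w \<in> cball z r" for w
        using N[OF subsetD[OF sub[OF \<open>z \<in> ?T\<close>] that] \<open>m \<ge> N\<close> \<open>n \<ge> N\<close>] by (simp add: dist_norm)
    qed (fact \<open>r > 0\<close>)
    then show ?thesis
      using \<open>r > 0\<close> by (intro exI[of _ N]) simp
  qed
  \<comment> \<open>The matrices converge entrywise; their columns are their values at the unit vectors.\<close>
  have "\<exists>G. (\<lambda>n. D n z) \<longlonglongrightarrow> G" if "z \<in> ?T" for z
  proof -
    have "Cauchy (\<lambda>n. D n z $ i $ j)" for i j
    proof (rule metric_CauchyI)
      fix e :: real assume "e > 0"
      then obtain N where "\<forall>m\<ge>N. \<forall>n\<ge>N. \<forall>z\<in>?T. \<forall>v. norm ((D m z - D n z) *v v) \<le> e / 2 * norm v"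
        using cauchy half_gt_zero by meson
      then have N: "norm ((D m z - D n z) *v v) \<le> e / 2 * norm v" if "m \<ge> N" "n \<ge> N" for m n v
        using that \<open>z \<in> ?T\<close> by simp
      have "dist (D m z $ i $ j) (D n z $ i $ j) < e" if "m \<ge> N" "n \<ge> N" for m n
      proof -
        have "(D m z - D n z) $ i $ j = ((D m z - D n z) *v axis j 1) $ i"
          by (simp add: matrix_vector_mult_def axis_def if_distrib cong: if_cong)
        then have "norm ((D m z - D n z) $ i $ j) \<le> e / 2 * norm (axis j 1 :: complex^2)"
          using N[OF that, of "axis j 1"] Finite_Cartesian_Product.norm_nth_le[of "(D m z - D n z) *v axis j 1" i]
          by simp
        then show ?thesis
          using \<open>e > 0\<close> by (simp add: dist_norm norm_axis)
      qed
      then show "\<exists>N. \<forall>m\<ge>N. \<forall>n\<ge>N. dist (D m z $ i $ j) (D n z $ i $ j) < e" by blast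
    qed
    then obtain G where "(\<lambda>n. D n z $ i $ j) \<longlonglongrightarrow> G i j" for i j
      unfolding Cauchy_convergent_iff convergent_def by metis
    then have "(\<lambda>n. D n z) \<longlonglongrightarrow> (\<chi> i j. G i j)"
      by (intro vec_tendstoI) simp
    then show ?thesis ..
  qed
  then obtain G where G: "\<And>z. z \<in> ?T \<Longrightarrow> (\<lambda>n. D n z) \<longlonglongrightarrow> G z"
    by metis
  have "\<exists>g'. \<forall>x\<in>?T. (\<lambda>n. f n x) \<longlonglongrightarrow> g' x \<and> (g' has_derivative (\<lambda>v. G x *v v)) (at x within ?T)"
  proof (rule has_derivative_sequence)
    show "(f n has_derivative (\<lambda>v. D n x *v v)) (at x within ?T)" if "x \<in> ?T" for n x
      by (rule has_derivative_at_withinI[OF D]) (use sub0 that in auto)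
    show "\<forall>\<^sub>F n in sequentially. \<forall>x\<in>?T. \<forall>h. norm (D n x *v h - G x *v h) \<le> e * norm h"
      if "e > 0" for e
    proof -
      obtain N where "\<forall>m\<ge>N. \<forall>n\<ge>N. \<forall>z\<in>?T. \<forall>v. norm ((D m z - D n z) *v v) \<le> e * norm v"
        using cauchy[OF \<open>e > 0\<close>] by meson
      then have N: "norm ((D m z - D n z) *v v) \<le> e * norm v" if "m \<ge> N" "n \<ge> N" "z \<in> ?T" for m n z v
        using that by simp
      have "norm (D n x *v h - G x *v h) \<le> e * norm h" if "n \<ge> N" "x \<in> ?T" for n x h
      proof (rule tendsto_upperbound)
        have "(\<lambda>m. (D m x *v h)) \<longlonglongrightarrow> G x *v h"
          using G[OF that(2)]
          by (intro vec_tendstoI) (auto simp: matrix_vector_mult_def intro!: tendsto_intros)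
        then show "(\<lambda>m. norm (D n x *v h - D m x *v h)) \<longlonglongrightarrow> norm (D n x *v h - G x *v h)"
          by (intro tendsto_intros)
        show "\<forall>\<^sub>F m in sequentially. norm (D n x *v h - D m x *v h) \<le> e * norm h"
          using N[OF that(1) _ that(2)] unfolding eventually_sequentially
          by (auto simp: matrix_vector_mult_diff_rdistrib)
      qed simp
      then show ?thesis unfolding eventually_sequentially by blast
    qed
    show "z0 \<in> ?T" using \<open>r > 0\<close> by simp
    show "(\<lambda>n. f n z0) \<longlonglongrightarrow> g z0"
      using tendsto_uniform_limitI[OF lim \<open>z0 \<in> S\<close>] .
  qed simp
  then obtain g' where g': "\<And>x. x \<in> ?T \<Longrightarrow> (\<lambda>n. f n x) \<longlonglongrightarrow> g' x"
    "\<And>x. x \<in> ?T \<Longrightarrow> (g' has_derivative (\<lambda>v. G x *v v)) (at x within ?T)" by blast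
  have eq: "g' x = g x" if "x \<in> ?T" for x
  proof (rule LIMSEQ_unique[OF g'(1)[OF that]])
    show "(\<lambda>n. f n x) \<longlonglongrightarrow> g x"
      by (rule tendsto_uniform_limitI[OF lim]) (use sub0 that in auto)
  qed
  have "(g' has_derivative (\<lambda>v. G z0 *v v)) (at z0)"
    using g'(2)[of z0] \<open>r > 0\<close> at_within_open[OF _ open_ball, of z0 z0 r] by simp
  then have "(g has_derivative (\<lambda>v. G z0 *v v)) (at z0)"
    by (rule has_derivative_transform_within_open[OF _ open_ball]) (use eq \<open>r > 0\<close> in auto)
  then show "\<exists>A::complex^2^2. (g has_derivative (\<lambda>v. A *v v)) (at z0)" ..
qed

section \<open>A Poincare function of a Henon map\<close>

text \<open>A Henon map fixing the origin, where its linear part is twice the swap of coordinates.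
  This linear part doubles norms, so the fixed point is repelling; its inverse is \<open>half_swap\<close>.\<close>

definition henon :: "complex^2 \<Rightarrow> complex^2" where
  "henon z = vector [(z $ 1)\<^sup>2 + 2 * z $ 2, 2 * z $ 1]"

definition half_swap :: "complex^2 \<Rightarrow> complex^2" where
  "half_swap z = vector [z $ 2 / 2, z $ 1 / 2]"

definition henon_conj :: "nat \<Rightarrow> complex^2 \<Rightarrow> complex^2" where
  "henon_conj n z = (henon ^^ n) ((half_swap ^^ n) z)"

lemma henon_conj_0 [simp]: "henon_conj 0 z = z"
  by (simp add: henon_conj_def)

lemma henon_conj_Suc: "henon_conj (Suc n) z = henon (henon_conj n (half_swap z))"
  by (simp add: henon_conj_def funpow_swap1)

lemma has_derivative_henon:
  "(henon has_derivative (\<lambda>v. vector [vector [2 * z $ 1, 2], vector [2, 0]] *v v)) (at z)"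
  by (rule has_derivative_vec2I)
     (auto simp: henon_def power2_eq_square algebra_simps
       intro!: derivative_eq_intros bounded_linear.has_derivative[OF bounded_linear_vec_nth])

lemma has_derivative_half_swap:
  "(half_swap has_derivative (\<lambda>v. vector [vector [0, 1/2], vector [1/2, 0]] *v v)) (at z)"
  by (rule has_derivative_vec2I)
     (auto simp: half_swap_def
       intro!: derivative_eq_intros bounded_linear.has_derivative[OF bounded_linear_vec_nth])

lemma norm_half_swap: "norm (half_swap z) = norm z / 2"
proof -
  have "norm (half_swap z) = sqrt (((norm (z $ 1))\<^sup>2 + (norm (z $ 2))\<^sup>2) / 2\<^sup>2)"
    by (simp add: norm_vec2 half_swap_def norm_divide power_divide add_divide_distrib)
  then show ?thesis
    by (simp only: real_sqrt_divide norm_vec2) simp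
qed

text \<open>The part linear in \<open>u - v\<close> contributes the factor \<open>2\<close>, the square in the first coordinate the rest.\<close>

lemma henon_diff:
  "norm (henon u - henon v) \<le> (2 + norm u + norm v) * norm (u - v)"
proof -
  have "henon u - henon v =
    vector [2 * (u - v) $ 2, 2 * (u - v) $ 1] + axis 1 ((u $ 1 + v $ 1) * (u - v) $ 1)"
    by (simp add: henon_def vec_eq_iff forall_2 axis_def power2_eq_square algebra_simps)
  also have "norm \<dots> \<le> norm (vector [2 * (u - v) $ 2, 2 * (u - v) $ 1] :: complex^2)
      + norm (axis 1 ((u $ 1 + v $ 1) * (u - v) $ 1) :: complex^2)"
    by (rule norm_triangle_ineq)
  also have "norm (vector [2 * (u - v) $ 2, 2 * (u - v) $ 1] :: complex^2) = 2 * norm (u - v)"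
  proof -
    have "norm (vector [2 * (u - v) $ 2, 2 * (u - v) $ 1] :: complex^2) = norm (2 *s (u - v))"
      by (simp only: norm_vec2) (simp add: power_mult_distrib norm_mult add.commute)
    then show ?thesis by (simp only: norm_vector_smult) simp
  qed
  also have "norm (axis 1 ((u $ 1 + v $ 1) * (u - v) $ 1) :: complex^2)
      \<le> (norm u + norm v) * norm (u - v)"
    unfolding norm_axis norm_mult
    by (intro mult_mono order_trans[OF norm_triangle_ineq] add_mono Finite_Cartesian_Product.norm_nth_le) auto
  finally show ?thesis by (simp add: algebra_simps)
qed

lemma henon_half_swap: "norm (henon (half_swap z) - z) \<le> (norm z)\<^sup>2 / 4"
proof -
  have "henon (half_swap z) - z = axis 1 ((half_swap z $ 1)\<^sup>2)"
    by (simp add: henon_def half_swap_def vec_eq_iff forall_2 axis_def)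
  then have "norm (henon (half_swap z) - z) = (norm (half_swap z $ 1))\<^sup>2"
    by (simp add: norm_axis norm_power)
  also have "\<dots> \<le> (norm (half_swap z))\<^sup>2"
    by (intro power_mono Finite_Cartesian_Product.norm_nth_le) auto
  finally show ?thesis by (simp add: norm_half_swap power_divide)
qed

text \<open>The bound reproduces itself: passing from \<open>z\<close> to \<open>half_swap z\<close> divides \<open>(norm z)\<^sup>2\<close> by \<open>4\<close>,
  the map \<open>henon\<close> is \<open>3\<close>-Lipschitz on the ball of radius \<open>1/2\<close>, and the quadratic term adds one more quarter.\<close>

lemma henon_conj_near_id:
  "norm z \<le> 1/2 \<Longrightarrow> norm (henon_conj n z - z) \<le> (norm z)\<^sup>2"
proof (induction n arbitrary: z)
  case (Suc n)
  let ?w = "half_swap z"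
  have w: "norm ?w \<le> 1/4" using Suc.prems by (simp add: norm_half_swap)
  have IH: "norm (henon_conj n ?w - ?w) \<le> (norm ?w)\<^sup>2" using Suc.IH[of ?w] w by simp
  also have "\<dots> \<le> (1/4)\<^sup>2" using w by (intro power_mono) auto
  finally have "norm (henon_conj n ?w) \<le> 1/2"
    using w norm_triangle_sub[of "henon_conj n ?w" ?w] by (simp add: power2_eq_square)
  then have "norm (henon (henon_conj n ?w) - henon ?w) \<le> 3 * (norm ?w)\<^sup>2"
    using w by (intro order_trans[OF henon_diff] mult_mono IH) auto
  then have "norm (henon (henon_conj n ?w) - henon ?w) \<le> 3 / 4 * (norm z)\<^sup>2"
    by (simp add: norm_half_swap power_divide)
  moreover have "henon_conj (Suc n) z - z
      = (henon (henon_conj n ?w) - henon ?w) + (henon ?w - z)"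
    by (simp add: henon_conj_Suc)
  ultimately show ?case
    using norm_triangle_ineq[of "henon (henon_conj n ?w) - henon ?w" "henon ?w - z"]
      henon_half_swap[of z] by simp
qed simp

lemma norm_henon_conj_le:
  assumes "norm z \<le> 1/4" shows "norm (henon_conj n z) \<le> 1/2"
proof -
  have "(norm z)\<^sup>2 \<le> (1/4)\<^sup>2" using assms by (intro power_mono) auto
  then show ?thesis
    using henon_conj_near_id[of z n] assms norm_triangle_sub[of "henon_conj n z" z]
    by (simp add: power2_eq_square)
qed

text \<open>The same gain drives the convergence: a Lipschitz factor \<open>3\<close> against a quadratic bound that shrinks
  by \<open>1/4\<close> leaves the ratio \<open>3/4\<close>.\<close>

lemma henon_conj_step:
  "norm z \<le> 1/2 \<Longrightarrow> norm (henon_conj (Suc n) z - henon_conj n z) \<le> (3/4)^n * (norm z)\<^sup>2"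
proof (induction n arbitrary: z)
  case 0
  show ?case using henon_conj_near_id[OF 0, of 1] by simp
next
  case (Suc n)
  let ?w = "half_swap z"
  have w: "norm ?w \<le> 1/4" using Suc.prems by (simp add: norm_half_swap)
  have "norm (henon_conj (Suc (Suc n)) z - henon_conj (Suc n) z)
      = norm (henon (henon_conj (Suc n) ?w) - henon (henon_conj n ?w))"
    by (simp only: henon_conj_Suc)
  also have "\<dots> \<le> 3 * ((3/4)^n * (norm ?w)\<^sup>2)"
    using w norm_henon_conj_le[OF w, of n] norm_henon_conj_le[OF w, of "Suc n"]
    by (intro order_trans[OF henon_diff] mult_mono Suc.IH) auto
  finally show ?case by (simp add: norm_half_swap power_divide)
qed

text \<open>The Poincare function of the repelling fixed point: it conjugates the linear part to \<open>henon\<close>.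
  The limit exists on the whole space, which is proved from the ball of radius \<open>1/2\<close> outwards.\<close>

definition henon_poincare :: "complex^2 \<Rightarrow> complex^2" where
  "henon_poincare z = lim (\<lambda>n. henon_conj n z)"

lemma holomorphic_henon_conj: "holomorphic2_on (henon_conj n) UNIV"
proof (induction n)
  case 0
  have "(henon_conj 0 has_derivative (\<lambda>v. mat 1 *v v)) (at z)" for z
    using has_derivative_ident[of "at z"] by (simp add: henon_conj_def[abs_def])
  then show ?case unfolding holomorphic2_on_def by blast
next
  case (Suc n)
  have "holomorphic2_on half_swap UNIV"
    using has_derivative_half_swap unfolding holomorphic2_on_def by blast
  moreover have "holomorphic2_on henon UNIV"
    using has_derivative_henon unfolding holomorphic2_on_def by blast
  ultimately have "holomorphic2_on (\<lambda>z. henon (henon_conj n (half_swap z))) UNIV"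
    using holomorphic2_on_compose[OF holomorphic2_on_compose[of half_swap UNIV "henon_conj n" UNIV],
        of henon UNIV] Suc by simp
  then show ?case by (rule holomorphic2_on_cong) (simp add: henon_conj_Suc)
qed

lemma uniform_limit_henon_conj:
  "uniform_limit (ball 0 (1/2)) henon_conj henon_poincare sequentially"
proof -
  define d where "d n z = henon_conj (Suc n) z - henon_conj n z" for n z
  have sum: "henon_conj n z = z + (\<Sum>k<n. d k z)" for n z
    using sum_lessThan_telescope[of "\<lambda>n. henon_conj n z" n] by (simp add: d_def)
  have "uniform_limit (ball 0 (1/2)) (\<lambda>n z. \<Sum>k<n. d k z) (\<lambda>z. \<Sum>k. d k z) sequentially"
  proof (rule Weierstrass_m_test)
    show "norm (d n z) \<le> (3/4)^n" if "z \<in> ball 0 (1/2)" for n z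
    proof -
      have "norm (d n z) \<le> (3/4)^n * (norm z)\<^sup>2"
        using that henon_conj_step[of z n] by (simp add: d_def)
      also have "\<dots> \<le> (3/4)^n * 1\<^sup>2"
        using that by (intro mult_left_mono power_mono) auto
      finally show ?thesis by simp
    qed
  qed simp
  then have u: "uniform_limit (ball 0 (1/2)) henon_conj (\<lambda>z. z + (\<Sum>k. d k z)) sequentially"
    unfolding sum[abs_def] by (rule uniform_limit_add[OF uniform_limit_const])
  have eq: "henon_poincare z = z + (\<Sum>k. d k z)" if "z \<in> ball 0 (1/2)" for z
    unfolding henon_poincare_def by (rule limI) (rule tendsto_uniform_limitI[OF u that])
  have "uniform_limit (ball 0 (1/2)) henon_conj henon_poincare sequentially
      \<longleftrightarrow> uniform_limit (ball 0 (1/2)) henon_conj (\<lambda>z. z + (\<Sum>k. d k z)) sequentially"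
    by (rule uniform_limit_cong') (auto simp: eq)
  then show ?thesis
    using u by blast
qed

text \<open>The region where the second coordinate is not dominant is forward invariant: once the first
  coordinate is large, its square outgrows everything, and the old first coordinate becomes (up to the
  factor \<open>2\<close>) the new second one.\<close>

lemma henon_preserves:
  assumes "norm (z $ 2) \<le> max 16 (norm (z $ 1))"
  shows "norm (henon z $ 2) \<le> max 16 (norm (henon z $ 1))"
proof (cases "norm (z $ 1) \<le> 8")
  case True
  then show ?thesis by (simp add: henon_def norm_mult)
next
  case False
  let ?a = "norm (z $ 1)"
  have "?a\<^sup>2 - 2 * norm (z $ 2) \<le> norm (henon z $ 1)"
    using norm_diff_ineq[of "(z $ 1)\<^sup>2" "2 * z $ 2"] by (simp add: henon_def norm_mult norm_power)
  moreover have "8 * ?a \<le> ?a\<^sup>2" using False mult_right_mono[of 8 ?a ?a] by (simp add: power2_eq_square)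
  moreover have "norm (z $ 2) \<le> 16 \<or> norm (z $ 2) \<le> ?a" using assms by auto
  ultimately have "2 * ?a \<le> norm (henon z $ 1)" using False by linarith
  then show ?thesis by (simp add: henon_def norm_mult)
qed

text \<open>Induction on dyadic radii. The functional equation \<open>F z = henon (F (half_swap z))\<close> transports
  convergence, holomorphy and the invariant region from a ball to the ball of twice the radius.\<close>

lemma henon_poincare_on_ball:
  defines "B \<equiv> \<lambda>k::nat. ball (0::complex^2) (2^k / 2)"
  shows "holomorphic2_on henon_poincare (B k) \<and>
    (\<forall>z\<in>B k. (\<lambda>n. henon_conj n z) \<longlonglongrightarrow> henon_poincare z \<and>
       norm (henon_poincare z $ 2) \<le> max 16 (norm (henon_poincare z $ 1)))"
proof (induction k)
  case 0
  have hol: "holomorphic2_on (henon_conj n) (ball 0 (1/2))" for n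
    using holomorphic_henon_conj[of n] by (simp add: holomorphic2_on_def)
  have small: "norm (henon_poincare z $ 2) \<le> max 16 (norm (henon_poincare z $ 1))"
    if z: "z \<in> ball 0 (1/2)" for z
  proof -
    have "norm (henon_conj n z) \<le> 1" for n
    proof -
      have "(norm z)\<^sup>2 \<le> (1/2)\<^sup>2" using z by (intro power_mono) auto
      then show ?thesis
        using henon_conj_near_id[of z n] z norm_triangle_sub[of "henon_conj n z" z]
        by (simp add: power2_eq_square)
    qed
    then have "norm (henon_poincare z) \<le> 1"
      by (intro tendsto_upperbound[OF tendsto_norm[OF tendsto_uniform_limitI[OF uniform_limit_henon_conj z]]]) auto
    then show ?thesis
      using Finite_Cartesian_Product.norm_nth_le[of "henon_poincare z" 2] by simp
  qed
  show ?case
    using holomorphic2_on_uniform_limit[OF hol uniform_limit_henon_conj] small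
      tendsto_uniform_limitI[OF uniform_limit_henon_conj] by (simp add: B_def)
next
  case (Suc k)
  have half: "half_swap z \<in> B k" if "z \<in> B (Suc k)" for z
    using that by (simp add: B_def norm_half_swap)
  have lim: "(\<lambda>n. henon_conj n z) \<longlonglongrightarrow> henon (henon_poincare (half_swap z))"
    if "z \<in> B (Suc k)" for z
  proof -
    have "isCont henon w" for w
      using has_derivative_henon has_derivative_continuous by blast
    then have "(\<lambda>n. henon (henon_conj n (half_swap z))) \<longlonglongrightarrow> henon (henon_poincare (half_swap z))"
      using Suc.IH half[OF that] by (intro isCont_tendsto_compose[where g = henon]) auto
    then have "(\<lambda>n. henon_conj (Suc n) z) \<longlonglongrightarrow> henon (henon_poincare (half_swap z))"
      by (simp only: henon_conj_Suc)
    then show ?thesis by (rule LIMSEQ_imp_Suc)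
  qed
  have eq: "henon_poincare z = henon (henon_poincare (half_swap z))" if "z \<in> B (Suc k)" for z
    unfolding henon_poincare_def[of z] by (rule limI) (rule lim[OF that])
  have "holomorphic2_on half_swap (B (Suc k))"
    using has_derivative_half_swap unfolding holomorphic2_on_def B_def by blast
  moreover have "holomorphic2_on henon UNIV"
    using has_derivative_henon unfolding holomorphic2_on_def by blast
  moreover have "half_swap ` B (Suc k) \<subseteq> B k"
    using half by blast
  ultimately have "holomorphic2_on (\<lambda>z. henon (henon_poincare (half_swap z))) (B (Suc k))"
    using holomorphic2_on_compose[OF holomorphic2_on_compose[of half_swap "B (Suc k)" henon_poincare "B k"],
        of henon UNIV] Suc.IH by simp
  then have hol: "holomorphic2_on henon_poincare (B (Suc k))"
    by (rule holomorphic2_on_cong) (rule eq)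
  show ?case
  proof (intro conjI ballI)
    fix z assume z: "z \<in> B (Suc k)"
    show "(\<lambda>n. henon_conj n z) \<longlonglongrightarrow> henon_poincare z"
      using lim[OF z] eq[OF z] by simp
    show "norm (henon_poincare z $ 2) \<le> max 16 (norm (henon_poincare z $ 1))"
      unfolding eq[OF z] by (rule henon_preserves) (use Suc.IH half[OF z] in simp)
  qed (rule hol)
qed

lemma in_dyadic_ball: "\<exists>k. z \<in> ball 0 (2^k / 2 :: real)" for z :: "'a::real_normed_vector"
proof -
  obtain k where "2 * norm z < 2 ^ k"
    using real_arch_pow[of 2 "2 * norm z"] by auto
  then show ?thesis by (intro exI[of _ k]) simp
qed

lemma holomorphic_henon_poincare: "holomorphic2_on henon_poincare UNIV"
  unfolding holomorphic2_on_def
proof (intro conjI ballI)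
  fix z :: "complex^2"
  obtain k where "z \<in> ball 0 (2^k / 2 :: real)" using in_dyadic_ball by blast
  then show "\<exists>A::complex^2^2. (henon_poincare has_derivative (\<lambda>v. A *v v)) (at z)"
    using conjunct1[OF henon_poincare_on_ball[of k]] unfolding holomorphic2_on_def by blast
qed simp

lemma henon_poincare_avoids:
  "norm (henon_poincare z $ 2) \<le> max 16 (norm (henon_poincare z $ 1))"
proof -
  obtain k where "z \<in> ball 0 (2^k / 2 :: real)" using in_dyadic_ball by blast
  then show ?thesis
    using conjunct2[OF henon_poincare_on_ball[of k]] by simp
qed

lemma henon_poincare_near_0:
  assumes "norm z < 1/2" shows "norm (henon_poincare z - z) \<le> (norm z)\<^sup>2"
proof (rule tendsto_upperbound)
  show "(\<lambda>n. norm (henon_conj n z - z)) \<longlonglongrightarrow> norm (henon_poincare z - z)"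
    using assms by (intro tendsto_intros tendsto_uniform_limitI[OF uniform_limit_henon_conj]) simp
qed (use assms henon_conj_near_id in auto)

text \<open>Immediate from the quadratic bound on \<open>F z - z\<close>; this is where the map is seen to be
  nondegenerate.\<close>

lemma has_derivative_henon_poincare_0:
  "(henon_poincare has_derivative (\<lambda>v. mat 1 *v v)) (at 0)"
proof -
  have F0: "henon_poincare 0 = 0" using henon_poincare_near_0[of 0] by simp
  have "((\<lambda>y. (henon_poincare y - y) /\<^sub>R norm y) \<longlongrightarrow> 0) (at 0)"
  proof (rule Lim_null_comparison)
    show "((\<lambda>y::complex^2. norm y) \<longlongrightarrow> 0) (at 0)"
      by (intro tendsto_norm_zero tendsto_ident_at)
    have "\<forall>\<^sub>F y in at 0. y \<in> ball (0::complex^2) (1/2)"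
      by (rule eventually_at_in_open') auto
    then show "\<forall>\<^sub>F y in at 0. norm ((henon_poincare y - y) /\<^sub>R norm y) \<le> norm y"
    proof eventually_elim
      case (elim y)
      then have "norm (henon_poincare y - y) \<le> norm y * norm y"
        using henon_poincare_near_0[of y] by (simp add: power2_eq_square)
      moreover have "norm ((henon_poincare y - y) /\<^sub>R norm y) = norm (henon_poincare y - y) / norm y"
        by (simp add: divide_inverse mult.commute)
      ultimately show ?case by (cases "y = 0") (simp_all add: divide_le_eq)
    qed
  qed
  then show ?thesis
    by (simp add: has_derivative_at_within F0)
qed

section \<open>An overshear adapted to strips\<close>

text \<open>The tolerance \<open>1/6\<close> is the largest for which \<open>cos (2 * pi * x)\<close> stays at least \<open>1/2\<close>.\<close>

definition near_int :: "real \<Rightarrow> bool" where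
  "near_int x \<longleftrightarrow> (\<exists>m::int. \<bar>x - of_int m\<bar> < 1/6)"

text \<open>The exponent of the overshear. Near the lines where \<open>Re z\<close> is an integer, the real part of the
  cosine grows exponentially in \<open>\<bar>Im z\<bar>\<close> because its factor \<open>cos (2 * pi * Re z)\<close> is at least \<open>1/2\<close>
  there. The summand \<open>z\<^sup>2\<close> provides growth along \<open>Re z\<close>, and the loss \<open>(Im z)\<^sup>2\<close> that it causes is
  absorbed by the cosine. Half of the factor \<open>136\<close> is \<open>64 + 4\<close>; the \<open>4\<close> pays for
  \<open>4 * norm z \<le> 4 + (norm z)\<^sup>2\<close>.\<close>

definition weight :: "complex \<Rightarrow> complex" where
  "weight z = 136 * cos (2 * of_real pi * z) + z\<^sup>2"

lemma Re_weight_ge: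
  assumes "near_int (Re z)" shows "64 + 4 * norm z \<le> Re (weight z)"
proof -
  obtain m :: int where m: "\<bar>Re z - of_int m\<bar> < 1/6"
    using assms unfolding near_int_def by blast
  define t where "t = Re z - of_int m"
  have "cos (2 * pi * Re z) = cos (2 * pi * t + 2 * pi * of_int m)"
    by (simp add: t_def algebra_simps)
  also have "\<dots> = cos (2 * pi * t)"
    by (simp add: cos_add cos_int_2pin sin_int_2pin)
  also have "\<dots> = cos \<bar>2 * pi * t\<bar>" by simp
  also have "\<dots> \<ge> cos (pi / 3)"
    using m pi_gt_zero by (intro cos_monotone_0_pi_le) (auto simp: t_def abs_mult)
  finally have c: "1/2 \<le> cos (2 * pi * Re z)"
    by (simp add: cos_60)
  have half: "2 + x\<^sup>2 / 2 \<le> exp x + exp (- x)" if "x \<ge> 0" for x :: real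
    using exp_lower_Taylor_quadratic[OF that] exp_ge_add_one_self[of "- x"] by linarith
  have ch: "2 + x\<^sup>2 / 2 \<le> exp x + exp (- x)" for x :: real
    using half[of x] half[of "- x"] by (cases "x \<ge> 0") (simp_all add: add.commute)
  have "2 * 2 \<le> pi * pi"
    using pi_ge_two by (intro mult_mono) auto
  then have "4 * (Im z)\<^sup>2 \<le> pi * pi * (Im z)\<^sup>2"
    by (intro mult_right_mono) auto
  then have "8 * (Im z)\<^sup>2 \<le> (2 * pi * Im z)\<^sup>2 / 2"
    by (simp add: power2_eq_square algebra_simps)
  then have E: "2 + 4 * (Im z)\<^sup>2 \<le> exp (2 * pi * Im z) + exp (- (2 * pi * Im z))"
    using ch[of "2 * pi * Im z"] zero_le_power2[of "Im z"] by linarith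
  define T where "T = cos (2 * pi * Re z) * (exp (2 * pi * Im z) + exp (- (2 * pi * Im z)))"
  have "1 / 2 * (2 + 4 * (Im z)\<^sup>2) \<le> T"
    unfolding T_def by (intro mult_mono c E order_trans[OF _ c]) auto
  then have "1 + 2 * (Im z)\<^sup>2 \<le> T" by simp
  moreover have "Re (weight z) = 68 * T + (Re z)\<^sup>2 - (Im z)\<^sup>2"
    by (simp add: weight_def T_def Re_cos power2_eq_square)
  moreover have "0 \<le> (Im z)\<^sup>2" by simp
  ultimately have "68 + (Im z)\<^sup>2 + (Re z)\<^sup>2 \<le> Re (weight z)"
    by linarith
  moreover have "4 * norm z \<le> 4 + (norm z)\<^sup>2"
    using zero_le_power2[of "norm z - 2"] by (simp add: power2_eq_square algebra_simps)
  ultimately show ?thesis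
    by (simp add: cmod_power2)
qed

text \<open>The inverse of the automorphism that multiplies the second coordinate by \<open>exp (weight (z $ 1))\<close>.\<close>

definition overshear :: "complex^2 \<Rightarrow> complex^2" where
  "overshear z = vector [z $ 1, z $ 2 * exp (- weight (z $ 1))]"

text \<open>A point with both real parts in the forbidden strips has second coordinate of modulus at least \<open>1/4\<close>,
  since its real part stays near \<open>1/2\<close> modulo \<open>1\<close>. Undoing the overshear multiplies that coordinate by
  an exponential larger than \<open>64\<close> and than four times the modulus of the first coordinate, hence lands
  where the second coordinate dominates.\<close>

lemma overshear_avoids:
  assumes "norm (z $ 2) \<le> max 16 (norm (z $ 1))"
  shows "\<not> (near_int (Re (overshear z $ 1)) \<and> near_int (Re (overshear z $ 2) - 1/2))"
proof
  assume near: "near_int (Re (overshear z $ 1)) \<and> near_int (Re (overshear z $ 2) - 1/2)"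
  then obtain m :: int where "\<bar>Re (overshear z $ 2) - 1/2 - of_int m\<bar> < 1/6"
    unfolding near_int_def by blast
  moreover have "real_of_int m \<ge> of_int 0 \<or> real_of_int m \<le> of_int (- 1)"
    unfolding of_int_le_iff by linarith
  then have "real_of_int m \<ge> 0 \<or> real_of_int m \<le> - 1" by simp
  ultimately have "1/4 \<le> norm (overshear z $ 2)"
    using abs_Re_le_cmod[of "overshear z $ 2"] by linarith
  also have "\<dots> = norm (z $ 2) / exp (Re (weight (z $ 1)))"
    by (simp add: overshear_def norm_mult exp_minus divide_inverse norm_inverse)
  finally have "exp (Re (weight (z $ 1))) \<le> 4 * norm (z $ 2)"
    by (simp add: field_simps)
  moreover have "64 + 4 * norm (z $ 1) \<le> Re (weight (z $ 1))"
    using near by (intro Re_weight_ge) (simp add: overshear_def)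
  moreover have "1 + Re (weight (z $ 1)) \<le> exp (Re (weight (z $ 1)))"
    by (rule exp_ge_add_one_self)
  moreover have "norm (z $ 2) \<le> 16 \<or> norm (z $ 2) \<le> norm (z $ 1)"
    using assms by auto
  ultimately show False
    using norm_ge_zero[of "z $ 1"] by linarith
qed

lemma has_derivative_overshear:
  "(overshear has_derivative (\<lambda>v. vector [vector [1, 0],
     vector [- z $ 2 * exp (- weight (z $ 1)) * deriv weight (z $ 1), exp (- weight (z $ 1))]] *v v)) (at z)"
proof (rule has_derivative_vec2I)
  have nth: "((\<lambda>x. x $ i) has_derivative (\<lambda>v. v $ i)) (at z)" for i :: 2
    by (rule bounded_linear_imp_has_derivative[OF bounded_linear_vec_nth])
  show "((\<lambda>x. overshear x $ 1) has_derivative (\<lambda>v. 1 * v $ 1 + 0 * v $ 2)) (at z)"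
    using nth[of 1] by (simp add: overshear_def)
  have "weight holomorphic_on UNIV"
    unfolding weight_def[abs_def] by (intro holomorphic_intros)
  then have "weight field_differentiable at (z $ 1)"
    by (rule holomorphic_on_imp_differentiable_at) auto
  then have "(weight has_derivative (\<lambda>v. deriv weight (z $ 1) * v)) (at (z $ 1))"
    using DERIV_deriv_iff_field_differentiable has_field_derivative_def by blast
  then have "((\<lambda>x. weight (x $ 1)) has_derivative (\<lambda>v. deriv weight (z $ 1) * v $ 1)) (at z)"
    using has_derivative_compose[OF nth] by blast
  note exp = has_derivative_compose[OF has_derivative_minus[OF this] DERIV_exp[unfolded has_field_derivative_def]]
  show "((\<lambda>x. overshear x $ 2) has_derivative
      (\<lambda>v. - z $ 2 * exp (- weight (z $ 1)) * deriv weight (z $ 1) * v $ 1 + exp (- weight (z $ 1)) * v $ 2)) (at z)"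
    using has_derivative_mult[OF nth[of 2] exp] by (simp add: overshear_def algebra_simps)
qed

lemma exists_dominating_avoiding_strips:
  "\<exists>G. holomorphic2_on G UNIV \<and> jacobian_det G 0 \<noteq> 0 \<and>
    (\<forall>z. \<not> (near_int (Re (G z $ 1)) \<and> near_int (Re (G z $ 2) - 1/2)))"
proof (intro exI conjI allI)
  let ?G = "\<lambda>z. overshear (henon_poincare z)"
  have "holomorphic2_on overshear UNIV"
    using has_derivative_overshear unfolding holomorphic2_on_def by blast
  then show "holomorphic2_on ?G UNIV"
    by (intro holomorphic2_on_compose[OF holomorphic_henon_poincare]) auto
  show "\<not> (near_int (Re (?G z $ 1)) \<and> near_int (Re (?G z $ 2) - 1/2))" for z
    by (intro overshear_avoids henon_poincare_avoids)
  show "jacobian_det ?G 0 \<noteq> 0"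
    using jacobian_det_eq[OF has_derivative_compose[OF has_derivative_henon_poincare_0 has_derivative_overshear, unfolded matrix_vector_mul_lid]]
    by (simp add: det_2)
qed

section \<open>Coordinates of a lattice\<close>

text \<open>The functionals are the dual basis of a lattice basis: they recover the integer coefficients of a
  lattice vector and vanish simultaneously only at \<open>0\<close>.\<close>

lemma full_lattice_real_coords:
  assumes "full_lattice L"
  obtains B and l :: "complex^2 \<Rightarrow> complex^2 \<Rightarrow> real"
  where "finite B" "\<And>b. linear (l b)" "\<And>b x. b \<in> B \<Longrightarrow> x \<in> L \<Longrightarrow> l b x \<in> \<int>"
    "\<And>v. (\<And>b. b \<in> B \<Longrightarrow> l b v = 0) \<Longrightarrow> v = 0"
proof -
  obtain B where B: "independent B" "card B = 4"
    and L: "L = {(\<Sum>b\<in>B. of_int (c b) *\<^sub>R b) | c :: complex^2 \<Rightarrow> int. True}"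
    using assms unfolding full_lattice_def by blast
  have fin: "finite B" using B(2) by (intro card_ge_0_finite) simp
  have "\<exists>l. linear l \<and> (\<forall>x\<in>B. l x = (if x = b then 1 else 0 :: real))" for b
    by (rule linear_independent_extend[OF B(1)])
  then obtain l where lin: "\<And>b. linear (l b :: complex^2 \<Rightarrow> real)"
    and l: "\<And>b x. x \<in> B \<Longrightarrow> l b x = (if x = b then 1 else 0)"
    by metis
  have comb: "l b (\<Sum>x\<in>B. c x *\<^sub>R x) = c b" if "b \<in> B" for b c
  proof -
    have "l b (\<Sum>x\<in>B. c x *\<^sub>R x) = (\<Sum>x\<in>B. c x * l b x)"
      by (simp add: linear_sum[OF lin] linear_scale[OF lin])
    also have "\<dots> = (\<Sum>x\<in>B. if x = b then c x else 0)"
      by (intro sum.cong) (auto simp: l)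
    finally show ?thesis using that fin by simp
  qed
  have span: "span B = UNIV"
  proof -
    have "dim B = DIM(complex^2)"
      using B by (simp add: dim_eq_card_independent)
    then show ?thesis by (simp only: dim_eq_full)
  qed
  show thesis
  proof (rule that[OF fin lin])
    show "l b x \<in> \<int>" if "b \<in> B" "x \<in> L" for b x
      using that by (auto simp: L comb)
    show "v = 0" if "\<And>b. b \<in> B \<Longrightarrow> l b v = 0" for v
    proof -
      have "v \<in> span B" using span by simp
      then obtain c where "v = (\<Sum>x\<in>B. c x *\<^sub>R x)"
        using fin by (auto simp: span_finite)
      then show ?thesis using that comb[of _ c] by simp
    qed
  qed
qed

text \<open>Two points of an open box of side one in the real lattice coordinates cannot differ by a nonzero lattice
  vector.\<close>

lemma exists_chart_range:
  assumes "full_lattice L" shows "\<exists>V. chart_range L V \<and> p \<in> V"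
proof -
  obtain B and l :: "complex^2 \<Rightarrow> complex^2 \<Rightarrow> real"
    where "finite B" and lin: "\<And>b. linear (l b)"
      and int: "\<And>b x. b \<in> B \<Longrightarrow> x \<in> L \<Longrightarrow> l b x \<in> \<int>"
      and zero: "\<And>v. (\<And>b. b \<in> B \<Longrightarrow> l b v = 0) \<Longrightarrow> v = 0"
    using full_lattice_real_coords[OF assms] by metis
  let ?V = "\<Inter>b\<in>B. {z. \<bar>l b (z - p)\<bar> < 1/2}"
  have "open {z. \<bar>l b (z - p)\<bar> < 1/2}" for b
  proof (rule open_Collect_less)
    have "continuous_on UNIV (l b)"
      using lin by (simp add: linear_continuous_on linear_conv_bounded_linear)
    then have "continuous_on UNIV (\<lambda>z. l b (z - p))"
      by (rule continuous_on_compose2[where f = "\<lambda>z. z - p"]) (auto intro!: continuous_on_diff)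
    then show "continuous_on UNIV (\<lambda>z. \<bar>l b (z - p)\<bar>)"
      by (rule continuous_on_rabs)
  qed simp
  then have "open ?V"
    using \<open>finite B\<close> by (intro open_INT) auto
  moreover have "inj_on (torus_proj L) ?V"
  proof (rule inj_onI)
    fix z w assume z: "z \<in> ?V" and w: "w \<in> ?V" and "torus_proj L z = torus_proj L w"
    then have "z - w \<in> L" using torus_proj_eq_iff[OF assms] by simp
    have "l b (z - w) = 0" if "b \<in> B" for b
    proof -
      have "l b (z - w) = l b (z - p) - l b (w - p)"
        by (simp add: linear_diff[OF lin, symmetric])
      moreover have "\<bar>l b (z - p)\<bar> < 1/2" "\<bar>l b (w - p)\<bar> < 1/2"
        using z w that by auto
      ultimately have "\<bar>l b (z - w)\<bar> < 1" by linarith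
      then show ?thesis
        using int[OF that \<open>z - w \<in> L\<close>] Ints_nonzero_abs_less1 by blast
    qed
    then show "z = w" using zero[of "z - w"] by simp
  qed
  moreover have "p \<in> ?V" by (simp add: linear_0[OF lin])
  ultimately show ?thesis unfolding chart_range_def by blast
qed

text \<open>Each real functional of the dual basis is the real part of a unique complex linear one. Two of these
  are linearly independent over the complex numbers: if all were multiples of a single one, a nonzero
  vector in its kernel would be killed by the whole dual basis.\<close>

lemma full_lattice_complex_coords:
  assumes "full_lattice L"
  obtains P :: "complex^2^2" where "det P \<noteq> 0" "\<And>x i. x \<in> L \<Longrightarrow> Re ((P *v x) $ i) \<in> \<int>"
proof -
  obtain B and l :: "complex^2 \<Rightarrow> complex^2 \<Rightarrow> real"
    where lin: "\<And>b. linear (l b)"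
      and int: "\<And>b x. b \<in> B \<Longrightarrow> x \<in> L \<Longrightarrow> l b x \<in> \<int>"
      and zero: "\<And>v. (\<And>b. b \<in> B \<Longrightarrow> l b v = 0) \<Longrightarrow> v = 0"
    using full_lattice_real_coords[OF assms] by metis
  define row :: "complex^2 \<Rightarrow> complex^2" where
    "row b = (\<chi> i. Complex (l b (axis i 1)) (- l b (axis i \<i>)))" for b
  have row: "Re (row b $ 1 * v $ 1 + row b $ 2 * v $ 2) = l b v" for b v
  proof -
    have "v = Re (v $ 1) *\<^sub>R axis 1 1 + Im (v $ 1) *\<^sub>R axis 1 \<i> +
        Re (v $ 2) *\<^sub>R axis 2 1 + Im (v $ 2) *\<^sub>R axis 2 \<i>"
      by (simp add: vec_eq_iff forall_2 axis_def complex_eq_iff)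
    then have "l b v = l b (Re (v $ 1) *\<^sub>R axis 1 1 + Im (v $ 1) *\<^sub>R axis 1 \<i> +
        Re (v $ 2) *\<^sub>R axis 2 1 + Im (v $ 2) *\<^sub>R axis 2 \<i>)" by simp
    then show ?thesis
      by (simp add: linear_add[OF lin] linear_scale[OF lin] row_def algebra_simps)
  qed
  define P where "P a b = (vector [row a, row b] :: complex^2^2)" for a b
  have P: "Re ((P a b *v v) $ 1) = l a v" "Re ((P a b *v v) $ 2) = l b v" for a b v
    using row by (simp_all add: P_def matrix_vector_mult_def sum_2)
  have "\<exists>a\<in>B. \<exists>b\<in>B. det (P a b) \<noteq> 0"
  proof (rule ccontr)
    assume "\<not> ?thesis"
    then have det: "row a $ 1 * row b $ 2 = row a $ 2 * row b $ 1" if "a \<in> B" "b \<in> B" for a b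
      using that by (auto simp: P_def det_2)
    have row0: "row a = 0" if "a \<in> B" for a
    proof -
      \<comment> \<open>This vector lies in the kernel of the functional with coefficients \<open>row a\<close>.\<close>
      define v :: "complex^2" where "v = vector [- row a $ 2, row a $ 1]"
      have "l b v = 0" if "b \<in> B" for b
        using row[of b v] det[OF \<open>a \<in> B\<close> that] by (simp add: v_def algebra_simps)
      then have "v = 0" by (rule zero)
      then show ?thesis by (simp add: v_def vec_eq_iff forall_2)
    qed
    have l0: "l b v = 0" if "b \<in> B" for b v
      using row[of b v] row0[OF that] by simp
    have "axis 1 1 = (0 :: complex^2)" by (rule zero) (rule l0)
    then show False by (simp add: axis_eq_0_iff)
  qed
  then obtain a b where ab: "a \<in> B" "b \<in> B" "det (P a b) \<noteq> 0" by blast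
  have "Re ((P a b *v x) $ i) \<in> \<int>" if "x \<in> L" for x i
    using exhaust_2[of i] int[OF ab(1) that] int[OF ab(2) that] P[of a b x] by auto
  with ab(3) show thesis by (rule that)
qed

text \<open>Dirichlet's simultaneous approximation theorem, without an enumeration of the set and without the
  bound on the denominator.\<close>

lemma simultaneous_approximation:
  assumes "finite A" "e > 0"
  obtains q :: nat where "q > 0" "\<And>a. a \<in> A \<Longrightarrow> \<exists>m::int. \<bar>of_nat q * a - of_int m\<bar> < (e::real)"
proof -
  obtain \<theta> :: "nat \<Rightarrow> real" and n where A: "A = \<theta> ` {i. i < n}"
    using finite_imp_nat_seg_image_inj_on[OF assms(1)] by blast
  obtain N :: nat where N: "N > 0" "1 / real N < e"
    using assms(2) by (metis inverse_eq_divide reals_Archimedean zero_less_Suc)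
  obtain q p where q: "0 < q" "\<And>i. i < n \<Longrightarrow> \<bar>of_int q * \<theta> i - of_int (p i)\<bar> < 1 / N"
    using Dirichlet_approx_simult[OF N(1)] by metis
  have "\<exists>m::int. \<bar>of_nat (nat q) * a - of_int m\<bar> < e" if "a \<in> A" for a
    using that q N(2) unfolding A by (force intro: less_trans)
  with q(1) show thesis by (intro that[of "nat q"]) auto
qed

section \<open>Maps into the torus\<close>

lemma torus_chart_proj:
  assumes "chart_range L V" "v \<in> V"
  shows "torus_chart L V (torus_proj L v) = v"
  using assms by (simp add: torus_chart_def chart_range_def the_inv_into_f_f)

text \<open>Near \<open>z\<close> the chart differs from \<open>f\<close> by the constant lattice vector \<open>c\<close> only.\<close>

lemma torus_chart_has_derivative:
  assumes L: "full_lattice L" and V: "chart_range L V"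
    and f: "(f has_derivative (\<lambda>v. A *v v)) (at z)" and z: "torus_proj L (f z) \<in> torus_proj L ` V"
    and cont: "continuous_on UNIV f"
  shows "(torus_chart L V \<circ> (\<lambda>z. torus_proj L (f z)) has_derivative (\<lambda>v. A *v v)) (at z)"
proof -
  obtain v where v: "v \<in> V" "torus_proj L (f z) = torus_proj L v"
    using z by auto
  define c where "c = v - f z"
  have c: "torus_proj L (w + c) = torus_proj L w" for w
    using v(2)[symmetric] by (simp add: c_def torus_proj_eq_iff[OF L])
  have "((\<lambda>z. f z + c) has_derivative (\<lambda>v. A *v v)) (at z)"
    using has_derivative_add_const[OF f] by simp
  then show ?thesis
  proof (rule has_derivative_transform_within_open)
    have "continuous_on UNIV (\<lambda>z. f z + c)"
      using cont by (intro continuous_intros) auto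
    then show "open ((\<lambda>z. f z + c) -` V)"
      using V by (simp add: chart_range_def continuous_on_open_vimage)
    show "z \<in> (\<lambda>z. f z + c) -` V" using v(1) by (simp add: c_def)
    show "f w + c = (torus_chart L V \<circ> (\<lambda>z. torus_proj L (f z))) w"
      if "w \<in> (\<lambda>z. f z + c) -` V" for w
      using torus_chart_proj[OF V, of "f w + c"] that by (simp add: c)
  qed
qed

lemma dominating_torus_proj:
  assumes L: "full_lattice L" and hol: "holomorphic2_on f UNIV" and jac: "jacobian_det f z0 \<noteq> 0"
  shows "dominating L (\<lambda>z. torus_proj L (f z))"
proof -
  have diff: "\<exists>A::complex^2^2. (f has_derivative (\<lambda>v. A *v v)) (at z)" for z
    using hol by (simp add: holomorphic2_on_def)
  then have cont: "continuous_on UNIV f"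
    by (meson continuous_at_imp_continuous_on has_derivative_continuous)
  then have cm: "continuous_map euclidean (torus_topology L) (\<lambda>z. torus_proj L (f z))"
    using continuous_map_compose[OF _ quotient_imp_continuous_map[OF quotient_map_torus_proj], of euclidean f L]
    by (simp add: o_def)
  have "holomorphic2_on (torus_chart L V \<circ> (\<lambda>z. torus_proj L (f z))) {z. torus_proj L (f z) \<in> torus_proj L ` V}"
    if V: "chart_range L V" for V
    unfolding holomorphic2_on_def
  proof (intro conjI ballI)
    have "torus_proj L -` torus_proj L ` V = (\<Union>l\<in>L. (\<lambda>z. z - l) -` V)"
    proof (intro set_eqI iffI)
      fix z assume "z \<in> torus_proj L -` torus_proj L ` V"
      then obtain v where "v \<in> V" "torus_proj L z = torus_proj L v" by auto
      then have "z - v \<in> L" "z \<in> (\<lambda>w. w - (z - v)) -` V" using torus_proj_eq_iff[OF L] by auto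
      then show "z \<in> (\<Union>l\<in>L. (\<lambda>z. z - l) -` V)" by blast
    next
      fix z assume "z \<in> (\<Union>l\<in>L. (\<lambda>z. z - l) -` V)"
      then obtain l where "l \<in> L" "z - l \<in> V" by auto
      moreover from this have "torus_proj L z = torus_proj L (z - l)"
        by (simp add: torus_proj_eq_iff[OF L])
      ultimately show "z \<in> torus_proj L -` torus_proj L ` V" by simp
    qed
    moreover have "open ((\<lambda>z. z - l) -` V)" for l
      using V by (intro continuous_open_vimage) (auto simp: chart_range_def intro!: continuous_intros)
    ultimately have "open (torus_proj L -` torus_proj L ` V)" by auto
    then have "open (f -` (torus_proj L -` torus_proj L ` V))"
      using cont by (simp add: continuous_on_open_vimage)
    then show "open {z. torus_proj L (f z) \<in> torus_proj L ` V}" by (simp add: vimage_def)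
    fix z assume "z \<in> {z. torus_proj L (f z) \<in> torus_proj L ` V}"
    then show "\<exists>A::complex^2^2. (torus_chart L V \<circ> (\<lambda>z. torus_proj L (f z)) has_derivative (\<lambda>v. A *v v)) (at z)"
      using diff[of z] torus_chart_has_derivative[OF L V _ _ cont] by blast
  qed
  with cm have "holomorphic_to_torus L (\<lambda>z. torus_proj L (f z))"
    by (simp add: holomorphic_to_torus_def)
  moreover obtain V where V: "chart_range L V" "f z0 \<in> V"
    using exists_chart_range[OF L] by blast
  moreover obtain A :: "complex^2^2" where A: "(f has_derivative (\<lambda>v. A *v v)) (at z0)"
    using diff by blast
  moreover have "jacobian_det (torus_chart L V \<circ> (\<lambda>z. torus_proj L (f z))) z0 = jacobian_det f z0"
    using jacobian_det_eq[OF torus_chart_has_derivative[OF L V(1) A _ cont]] jacobian_det_eq[OF A] V(2) by simp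
  ultimately show ?thesis
    unfolding dominating_def using jac by (metis imageI)
qed

section \<open>Avoiding a neighbourhood of a finite set\<close>

lemma near_int_add_int: "k \<in> \<int> \<Longrightarrow> near_int (x + k) \<longleftrightarrow> near_int x"
proof -
  have *: "near_int (x + of_int k)" if "near_int x" for x and k :: int
    using that unfolding near_int_def by (metis add_diff_cancel_right of_int_add)
  assume "k \<in> \<int>"
  then obtain j where "k = of_int j" by (auto elim: Ints_cases)
  then show ?thesis using *[of x j] *[of "x + of_int j" "- j"] by auto
qed

lemma open_near_int: "open {x. near_int x}"
proof -
  have "{x. near_int x} = (\<Union>m::int. ball (of_int m) (1/6))"
    by (auto simp: near_int_def dist_real_def abs_minus_commute)
  then show ?thesis by auto
qed

text \<open>Passing from \<open>P\<close> to its multiple \<open>Q\<close> by the integer \<open>q\<close> makes both real parts nearly integral at the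
  points of \<open>E\<close> and keeps them integral at lattice vectors. The points where both real parts are nearly
  integral form a lattice periodic open set, whose image in the torus is the one to be avoided. The map \<open>G\<close> avoids the points whose first
  real part is near an integer and whose second real part is near a half integer, which explains the
  translation by \<open>1/2\<close>.\<close>

theorem corollary6p2:
  fixes L :: "(complex^2) set" and E :: "(complex^2) set set"
  assumes "full_lattice L" and "E \<subseteq> torus L" and "finite E"
  shows "\<exists>U. openin (torus_topology L) U \<and> E \<subseteq> U \<and>
           (\<exists>F :: complex^2 \<Rightarrow> (complex^2) set. dominating L F \<and> range F \<subseteq> torus L - U)"
proof -
  obtain P :: "complex^2^2" where P: "det P \<noteq> 0" "\<And>x i. x \<in> L \<Longrightarrow> Re ((P *v x) $ i) \<in> \<int>"
    using full_lattice_complex_coords[OF assms(1)] by blast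
  obtain E' where E': "finite E'" "E = torus_proj L ` E'"
    using assms(2,3) unfolding torus_def by (metis finite_subset_image subset_image_iff)
  define A where "A = (\<lambda>(e, i). Re ((P *v e) $ i)) ` (E' \<times> UNIV)"
  have "finite A" using E'(1) by (simp add: A_def)
  then obtain q :: nat where q: "q > 0" and qA: "\<And>a. a \<in> A \<Longrightarrow> near_int (of_nat q * a)"
    using simultaneous_approximation[of A "1/6"] unfolding near_int_def by auto
  define Q :: "complex^2^2" where "Q = (\<chi> i j. of_nat q * P $ i $ j)"
  have Q: "Re ((Q *v z) $ i) = of_nat q * Re ((P *v z) $ i)" for z i
    by (simp add: Q_def matrix_vector_mult_def sum_2 algebra_simps)
  have "det Q = (of_nat q)\<^sup>2 * det P"
    by (simp add: Q_def det_2 power2_eq_square algebra_simps)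
  then have "invertible Q"
    using P(1) q by (simp add: invertible_det_nz)
  then obtain R where inv: "Q ** R = mat 1" unfolding invertible_def by blast
  define O' where "O' = {z. \<forall>i. near_int (Re ((Q *v z) $ i))}"
  have per: "z + x \<in> O' \<longleftrightarrow> z \<in> O'" if "x \<in> L" for z x
  proof -
    have "Re ((Q *v x) $ i) \<in> \<int>" for i
      unfolding Q by (intro Ints_mult P(2) that) auto
    then show ?thesis
      by (simp add: O'_def matrix_vector_right_distrib near_int_add_int)
  qed
  have sat: "torus_proj L z \<in> torus_proj L ` O' \<longleftrightarrow> z \<in> O'" for z
  proof
    assume "torus_proj L z \<in> torus_proj L ` O'"
    then obtain w where "w \<in> O'" "z - w \<in> L" using torus_proj_eq_iff[OF assms(1)] by auto
    then show "z \<in> O'" using per[of "z - w" w] by simp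
  qed blast
  have "open O'"
  proof -
    have "O' = (\<Inter>i. (\<lambda>z. Re ((Q *v z) $ i)) -` {x. near_int x})"
      by (auto simp: O'_def)
    moreover have "open ((\<lambda>z. Re ((Q *v z) $ i)) -` {x. near_int x})" for i
      unfolding matrix_vector_mult_def
      by (intro continuous_open_vimage open_near_int) (auto intro!: continuous_intros)
    ultimately show ?thesis by auto
  qed
  then have U: "openin (torus_topology L) (torus_proj L ` O')"
    by (simp add: openin_torus_topology torus_def image_mono vimage_def sat)
  have E: "E \<subseteq> torus_proj L ` O'"
    using qA by (auto simp: E'(2) A_def O'_def Q)
  obtain G where G: "holomorphic2_on G UNIV" "jacobian_det G 0 \<noteq> 0"
    "\<And>z. \<not> (near_int (Re (G z $ 1)) \<and> near_int (Re (G z $ 2) - 1/2))"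
    using exists_dominating_avoiding_strips by blast
  define f where "f z = R *v (G z - axis 2 (1/2))" for z
  have "Q *v f z = G z - axis 2 (1/2)" for z
    by (simp add: f_def matrix_vector_mul_assoc inv)
  then have avoid: "f z \<notin> O'" for z
    using G(3)[of z] by (auto simp: O'_def forall_2 axis_def)
  have f_der: "(f has_derivative (\<lambda>v. (R ** D) *v v)) (at z)"
    if "(G has_derivative (\<lambda>v. D *v v)) (at z)" for z and D :: "complex^2^2"
  proof -
    have "((\<lambda>z. G z - axis 2 (1/2)) has_derivative (\<lambda>v. D *v v)) (at z)"
      using has_derivative_diff[OF that has_derivative_const] by simp
    from bounded_linear.has_derivative[OF matrix_vector_mul_bounded_linear this]
    show ?thesis by (simp add: f_def[abs_def] matrix_vector_mul_assoc)
  qed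
  have hol: "holomorphic2_on f UNIV"
    using G(1) f_der unfolding holomorphic2_on_def by blast
  have jac: "jacobian_det f 0 \<noteq> 0"
  proof -
    obtain D :: "complex^2^2" where D: "(G has_derivative (\<lambda>v. D *v v)) (at 0)"
      using G(1) unfolding holomorphic2_on_def by blast
    have "det Q * det R = 1"
      using inv by (metis det_I det_mul)
    then show ?thesis
      using G(2) by (auto simp: jacobian_det_eq[OF D] jacobian_det_eq[OF f_der[OF D]] det_mul)
  qed
  have "torus_proj L (f z) \<notin> torus_proj L ` O'" for z
    using avoid sat by simp
  then have "range (\<lambda>z. torus_proj L (f z)) \<subseteq> torus L - torus_proj L ` O'"
    unfolding torus_def by blast
  with U E dominating_torus_proj[OF assms(1) hol jac] show ?thesis
    by blast
qed

end
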